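(* Let $n\ge1$ and $a=(a_0,\dots,a_n)\in(\mathbb{R}\cup\{\infty\})^{n+1}$ with $a_0,a_n<\infty$. If $a$ is not regular, then $H(a)\ge 1/6$.
   Context: $a$ is regular if the set $J=\{i: a_i<\infty\}$ is an arithmetic progression and each point $(i,a_i)$, $i\in J$, is a vertex of the Newton polygon $P(a)$, which is the convex hull of the vertical rays $\{(i,b): b\ge a_i\}$, $i\in J$. For an integer $s\ge 0$ let $D_s\subset\mathbb{R}^s$ be the set of real vectors $z=(z_1,\dots,z_s)$ such that for every $0\le k\le s-1-n$ the minimum $\min_{0\le i\le n}\{a_i+z_{k+1+i}\}$ is attained for at least two different indices $i$; $D_s$ is a polyhedral complex, $d_s=\dim D_s$, and the tropical entropy is $H(a)=\lim_{s\to\infty}d_s/s$. *)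

theory Defs
  imports "HOL-Analysis.Analysis" "HOL-Library.Extended_Real"
begin

text \<open>A tropical coefficient vector a = (a_0,...,a_n) with entries in R \<union> {\<infinity>} is
  modelled as a function a :: nat \<Rightarrow> ereal, of which only the values a 0, ..., a n matter;
  the entries are assumed to be different from -\<infinity>.\<close>

definition finite_support :: "(nat \<Rightarrow> ereal) \<Rightarrow> nat \<Rightarrow> nat set" where
  "finite_support a n = {i. i \<le> n \<and> a i \<noteq> \<infinity>}"

definition arith_prog :: "nat set \<Rightarrow> bool" where
  "arith_prog J \<longleftrightarrow> (\<exists>b d m. J = {b + d * j | j. j \<le> m})"

definition newton_polygon :: "(nat \<Rightarrow> ereal) \<Rightarrow> nat \<Rightarrow> (real \<times> real) set" where
  "newton_polygon a n =
     convex hull {(real i, b) | i b. i \<in> finite_support a n \<and> a i \<le> ereal b}"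

definition regular :: "(nat \<Rightarrow> ereal) \<Rightarrow> nat \<Rightarrow> bool" where
  "regular a n \<longleftrightarrow> arith_prog (finite_support a n) \<and>
     (\<forall>i \<in> finite_support a n.
        (real i, real_of_ereal (a i)) extreme_point_of newton_polygon a n)"

definition min_twice :: "nat \<Rightarrow> (nat \<Rightarrow> ereal) \<Rightarrow> bool" where
  "min_twice n f \<longleftrightarrow> (\<exists>i j. i \<le> n \<and> j \<le> n \<and> i \<noteq> j \<and>
       f i = Min (f ` {..n}) \<and> f j = Min (f ` {..n}))"

text \<open>D_s \<subseteq> R^s: vectors z = (z_1,...,z_s) are functions nat \<Rightarrow> real vanishing outside {1..s}.
  The condition for 0 \<le> k \<le> s-1-n is written as k + n + 1 \<le> s.\<close>
definition tropD :: "(nat \<Rightarrow> ereal) \<Rightarrow> nat \<Rightarrow> nat \<Rightarrow> (nat \<Rightarrow> real) set" where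
  "tropD a n s = {z. (\<forall>j. j \<notin> {1..s} \<longrightarrow> z j = 0) \<and>
      (\<forall>k. k + n + 1 \<le> s \<longrightarrow> min_twice n (\<lambda>i. a i + ereal (z (k + 1 + i))))}"

definition aff_indep :: "nat \<Rightarrow> nat \<Rightarrow> (nat \<Rightarrow> nat \<Rightarrow> real) \<Rightarrow> bool" where
  "aff_indep s k p \<longleftrightarrow> (\<forall>c :: nat \<Rightarrow> real.
      (\<forall>j \<in> {1..s}. (\<Sum>i\<in>{1..k}. c i * (p i j - p 0 j)) = 0) \<longrightarrow> (\<forall>i\<in>{1..k}. c i = 0))"

definition contains_simplex :: "nat \<Rightarrow> (nat \<Rightarrow> real) set \<Rightarrow> nat \<Rightarrow> bool" where
  "contains_simplex s S k \<longleftrightarrow> (\<exists>p. (\<forall>i\<le>k. \<forall>j. j \<notin> {1..s} \<longrightarrow> p i j = 0) \<and> aff_indep s k p \<and>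
      (\<forall>l :: nat \<Rightarrow> real. (\<forall>i\<le>k. l i \<ge> 0) \<and> (\<Sum>i\<le>k. l i) = 1 \<longrightarrow>
          (\<lambda>j. \<Sum>i\<le>k. l i * p i j) \<in> S))"

definition poly_dim :: "nat \<Rightarrow> (nat \<Rightarrow> real) set \<Rightarrow> nat" where
  "poly_dim s S = Sup {k. contains_simplex s S k}"

definition d_seq :: "(nat \<Rightarrow> ereal) \<Rightarrow> nat \<Rightarrow> nat \<Rightarrow> nat" where
  "d_seq a n s = poly_dim s (tropD a n s)"

definition trop_entropy :: "(nat \<Rightarrow> ereal) \<Rightarrow> nat \<Rightarrow> real" where
  "trop_entropy a n = lim (\<lambda>s. real (d_seq a n s) / real s)"

end

theory Submission
  imports Defs
begin

text \<open>Restricting a simplex in $D_{s+t}$ to the first $s$ and to the last $t$ coordinates gives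
  $d_{s+t} \<le> d_s + d_t$, so $d_s / s$ converges by Fekete's lemma.

  For the lower bound, suppose that a line supporting the Newton polygon touches it at
  $p < q$, and subtract it, so that $a_p = a_q = 0$ and $a \<ge> 0$; put $m = q - p$. If some finite
  $a_j$ has $j \<not>\<equiv> p$ modulo $m$, let $h = a_r$ be the least of these. Choose a set $C$ of
  at least $m/3$ residues with $C \<inter> (C + r - p) = \<emptyset>$, let $z$ be $0$ on the residue classes
  outside $C$, and on the classes in $C$ let $z$ be alternately $h$ and an arbitrary value
  $\<ge> h$. A window whose $p$-th entry has its residue outside $C$ attains the minimum $0$ at $p$ and $q$;
  any other window attains the minimum $h$ at $r$ and at one of $p$, $q$. This leaves
  about $s/6$ free coordinates. If there is no such line, then for every edge $[p, q]$ the length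
  $q - p$ divides all differences of elements of $J$; hence all edges have the same length and no
  point of $J$ lies between two consecutive vertices.\<close>

section \<open>Linear independence of restrictions\<close>

text \<open>Linear independence of an indexed family, read on the coordinates in \<open>A\<close>
  only. Keeping \<open>A\<close> as a parameter lets the same vectors be tested on different blocks
  of coordinates.\<close>

definition indep_on :: "'b set \<Rightarrow> 'a set \<Rightarrow> ('a \<Rightarrow> 'b \<Rightarrow> real) \<Rightarrow> bool" where
  "indep_on A I v \<longleftrightarrow> (\<forall>c. (\<forall>j\<in>A. (\<Sum>i\<in>I. c i * v i j) = 0) \<longrightarrow> (\<forall>i\<in>I. c i = 0))"

text \<open>A homogeneous linear system with more unknowns than equations has a nonzero solution.
  This is Gaussian elimination, by induction on the set of equations.\<close>

lemma indep_on_card_le: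
  fixes A :: "'b set" and I :: "'a set"
  assumes "finite A" "finite I" "indep_on A I v"
  shows "card I \<le> card A"
proof -
  have dependent: "\<exists>c. (\<forall>j\<in>A. (\<Sum>i\<in>I. c i * v i j) = 0) \<and> (\<exists>i\<in>I. c i \<noteq> 0)"
    if "finite A" "finite I" "card A < card I" for A :: "'b set" and I :: "'a set" and v :: "'a \<Rightarrow> 'b \<Rightarrow> real"
    using that
  proof (induction A arbitrary: I v rule: finite_induct)
    case empty
    then obtain i where "i \<in> I" by fastforce
    then show ?case by (intro exI[of _ "\<lambda>_::'a. 1::real"]) auto
  next
    case (insert e A)
    show ?case
    proof (cases "\<forall>i\<in>I. v i e = 0")
      case True
      then show ?thesis using insert.IH[of I v] insert.prems insert.hyps by auto
    next
      case False
      then obtain p where p: "p \<in> I" "v p e \<noteq> 0" by auto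
      let ?I = "I - {p}"
      \<comment> \<open>Elimination with pivot \<open>v p e\<close>: subtracting a multiple of
        \<open>v p\<close> makes coordinate \<open>e\<close> of every \<open>w i\<close>
        vanish.\<close>
      define w where "w i j = v i j - v p j * v i e / v p e" for i j
      have "card A < card ?I" using insert p by auto
      then obtain c where c: "\<And>j. j \<in> A \<Longrightarrow> (\<Sum>i\<in>?I. c i * w i j) = 0" "\<exists>i\<in>?I. c i \<noteq> 0"
        using insert.IH[of ?I w] insert.prems by auto
      \<comment> \<open>The value at \<open>p\<close> is the one that solves equation
        \<open>e\<close>; with it, the sums over \<open>v\<close> on the other coordinates reduce to
        the sums over \<open>w\<close>.\<close>
      define c' where "c' = c(p := - (\<Sum>i\<in>?I. c i * v i e) / v p e)"
      have sum_c': "(\<Sum>i\<in>I. c' i * v i j) = c' p * v p j + (\<Sum>i\<in>?I. c i * v i j)" for j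
      proof -
        have "(\<Sum>i\<in>I. c' i * v i j) = c' p * v p j + (\<Sum>i\<in>?I. c' i * v i j)"
          using p insert.prems by (simp add: sum.remove)
        also have "(\<Sum>i\<in>?I. c' i * v i j) = (\<Sum>i\<in>?I. c i * v i j)"
          by (intro sum.cong) (auto simp: c'_def)
        finally show ?thesis .
      qed
      have "(\<Sum>i\<in>I. c' i * v i j) = 0" if "j \<in> insert e A" for j
      proof (cases "j = e")
        case True
        then show ?thesis unfolding sum_c' using p by (simp add: c'_def)
      next
        case False
        have "(\<Sum>i\<in>?I. c i * w i j)
            = (\<Sum>i\<in>?I. c i * v i j) - (\<Sum>i\<in>?I. c i * v i e) * (v p j / v p e)"
          unfolding w_def sum_subtractf[symmetric] sum_distrib_right
          by (intro sum.cong) (auto simp: algebra_simps)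
        with c(1)[of j] False that show ?thesis unfolding sum_c' by (simp add: c'_def)
      qed
      moreover have "\<exists>i\<in>I. c' i \<noteq> 0" using c(2) by (auto simp: c'_def)
      ultimately show ?thesis by blast
    qed
  qed
  show ?thesis
  proof (rule ccontr)
    assume "\<not> card I \<le> card A"
    then have "card A < card I" by simp
    from dependent[OF assms(1,2) this, of v] assms(3) show False unfolding indep_on_def by blast
  qed
qed

text \<open>An inclusion-maximal subfamily that is independent on \<open>A\<close> spans all
  restrictions to \<open>A\<close>; \<open>M i\<close> holds the coefficients of
  \<open>v i\<close>.\<close>

lemma indep_on_basis:
  assumes "finite I"
  shows "\<exists>K M. K \<subseteq> I \<and> indep_on A K v \<and> (\<forall>i\<in>I. \<forall>j\<in>A. v i j = (\<Sum>l\<in>K. M i l * v l j))"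
proof -
  let ?S = "{K \<in> Pow I. indep_on A K v}"
  have "{} \<in> ?S" by (simp add: indep_on_def)
  moreover have "finite ?S" using assms by simp
  ultimately obtain K where KS: "K \<in> ?S" and mx: "\<forall>L\<in>?S. K \<subseteq> L \<longrightarrow> K = L"
    using finite_has_maximal[of ?S] by blast
  then have K: "K \<subseteq> I \<and> indep_on A K v" by simp
  have finK: "finite K" using K assms finite_subset by auto
  have "\<exists>m. \<forall>j\<in>A. v i j = (\<Sum>l\<in>K. m l * v l j)" if i: "i \<in> I" for i
  proof (cases "i \<in> K")
    case True
    have "v i j = (\<Sum>l\<in>K. (if l = i then 1 else 0) * v l j)" for j
      using True finK by (simp add: if_distrib[of "\<lambda>x. x * _"] cong: if_cong)
    then show ?thesis by (intro exI[of _ "\<lambda>l. if l = i then 1 else 0"] ballI)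
  next
    case False
    then have "\<not> indep_on A (insert i K) v" using mx K i by blast
    then obtain c where c: "\<And>j. j \<in> A \<Longrightarrow> (\<Sum>l\<in>insert i K. c l * v l j) = 0"
      "\<exists>l\<in>insert i K. c l \<noteq> 0" unfolding indep_on_def by auto
    then have eq: "\<And>j. j \<in> A \<Longrightarrow> c i * v i j + (\<Sum>l\<in>K. c l * v l j) = 0"
      using False finK by simp
    \<comment> \<open>Otherwise the relation would live on \<open>K\<close> alone, against its
      independence; dividing by \<open>c i\<close> then expresses \<open>v i\<close> through
      \<open>K\<close>.\<close>
    have "c i \<noteq> 0"
    proof
      assume "c i = 0"
      then have "\<forall>l\<in>K. c l = 0" using eq K unfolding indep_on_def by auto
      with c(2) \<open>c i = 0\<close> show False by auto
    qed
    have "v i j = (\<Sum>l\<in>K. (- c l / c i) * v l j)" if "j \<in> A" for j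
    proof -
      have "(\<Sum>l\<in>K. (- c l / c i) * v l j) = - (\<Sum>l\<in>K. c l * v l j) / c i"
        by (simp add: sum_negf sum_divide_distrib)
      also have "\<dots> = v i j" using eq[OF that] \<open>c i \<noteq> 0\<close> by (simp add: field_simps)
      finally show ?thesis by simp
    qed
    then show ?thesis by (intro exI[of _ "\<lambda>l. - c l / c i"] ballI)
  qed
  then have "\<exists>M. \<forall>i\<in>I. \<forall>j\<in>A. v i j = (\<Sum>l\<in>K. M i l * v l j)" by (intro bchoice ballI)
  with K show ?thesis by blast
qed

text \<open>The rank on a union of coordinate sets is at most the sum of the ranks. A vector is
  determined on \<open>A\<close> and \<open>B\<close> by its coefficients in bases of the two
  restrictions, so independence passes to these coefficient vectors.\<close>

lemma indep_on_Un:
  assumes I: "finite I" and ind: "indep_on (A \<union> B) I v"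
  obtains K L where "K \<subseteq> I" "L \<subseteq> I" "indep_on A K v" "indep_on B L v"
    "card I \<le> card K + card L"
proof -
  obtain K M where K: "K \<subseteq> I" "indep_on A K v"
    "\<forall>i\<in>I. \<forall>j\<in>A. v i j = (\<Sum>l\<in>K. M i l * v l j)"
    using indep_on_basis[OF I, of A v] by blast
  obtain L N where L: "L \<subseteq> I" "indep_on B L v"
    "\<forall>i\<in>I. \<forall>j\<in>B. v i j = (\<Sum>l\<in>L. N i l * v l j)"
    using indep_on_basis[OF I, of B v] by blast
  have fin: "finite K" "finite L" using finite_subset[OF K(1) I] finite_subset[OF L(1) I] by auto
  \<comment> \<open>A disjoint sum indexes the coefficients because \<open>K\<close> and
    \<open>L\<close> may share elements of \<open>I\<close>.\<close>
  define W where "W i = case_sum (M i) (N i)" for i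
  have "indep_on (K <+> L) I W"
    unfolding indep_on_def
  proof (intro allI impI)
    fix c assume "\<forall>j\<in>K <+> L. (\<Sum>i\<in>I. c i * W i j) = 0"
    then have M0: "(\<Sum>i\<in>I. c i * M i l) = 0" if "l \<in> K" for l using that by (force simp: W_def)
    have N0: "(\<Sum>i\<in>I. c i * N i l) = 0" if "l \<in> L" for l
      using \<open>\<forall>j\<in>K <+> L. _\<close> that by (force simp: W_def)
    have "(\<Sum>i\<in>I. c i * v i j) = 0" if "j \<in> A" for j
    proof -
      have "(\<Sum>i\<in>I. c i * v i j) = (\<Sum>i\<in>I. \<Sum>l\<in>K. c i * M i l * v l j)"
        using K(3) that by (simp add: sum_distrib_left mult.assoc)
      also have "\<dots> = (\<Sum>l\<in>K. (\<Sum>i\<in>I. c i * M i l) * v l j)"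
        by (subst sum.swap) (simp add: sum_distrib_right)
      finally show ?thesis using M0 by simp
    qed
    moreover have "(\<Sum>i\<in>I. c i * v i j) = 0" if "j \<in> B" for j
    proof -
      have "(\<Sum>i\<in>I. c i * v i j) = (\<Sum>i\<in>I. \<Sum>l\<in>L. c i * N i l * v l j)"
        using L(3) that by (simp add: sum_distrib_left mult.assoc)
      also have "\<dots> = (\<Sum>l\<in>L. (\<Sum>i\<in>I. c i * N i l) * v l j)"
        by (subst sum.swap) (simp add: sum_distrib_right)
      finally show ?thesis using N0 by simp
    qed
    ultimately show "\<forall>i\<in>I. c i = 0" using ind unfolding indep_on_def by blast
  qed
  then have "card I \<le> card (K <+> L)" using indep_on_card_le[of "K <+> L" I W] I fin by simp
  then have "card I \<le> card K + card L" using fin by (simp add: card_Plus)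
  then show ?thesis by (rule that[OF K(1) L(1) K(2) L(2)])
qed

section \<open>Subadditive sequences\<close>

text \<open>The limit is the infimum of the quotients. Division of s with remainder by a nearly
  optimal m bounds \<open>f s\<close> by a multiple of \<open>f m\<close> plus a bounded
  error.\<close>

lemma fekete:
  fixes f :: "nat \<Rightarrow> real"
  assumes nonneg: "\<And>s. 0 \<le> f s" and sub: "\<And>s t. f (s + t) \<le> f s + f t"
  shows "convergent (\<lambda>s. f s / real s)"
proof -
  define L where "L = (INF s\<in>{1..}. f s / real s)"
  have bdd: "bdd_below ((\<lambda>s. f s / real s) ` {1..})"
    by (rule bdd_belowI[of _ 0]) (auto simp: nonneg)
  have mult: "f (k * m + r) \<le> real k * f m + f r" for k m r
  proof (induction k)
    case (Suc k)
    have "f (Suc k * m + r) \<le> f m + f (k * m + r)" using sub[of m "k * m + r"] by (simp add: add.assoc)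
    with Suc show ?case by (simp add: algebra_simps)
  qed simp
  have "(\<lambda>s. f s / real s) \<longlonglongrightarrow> L"
  proof (rule LIMSEQ_I)
    fix e :: real assume "0 < e"
    have "\<exists>x\<in>(\<lambda>s. f s / real s) ` {1..}. x < L + e / 2"
      using cInf_lessD[of "(\<lambda>s. f s / real s) ` {1..}" "L + e/2"] \<open>0 < e\<close> by (auto simp: L_def)
    then obtain m where m: "1 \<le> m" "f m / real m < L + e / 2" by auto
    \<comment> \<open>\<open>B\<close> bounds \<open>f\<close> at every possible remainder modulo
      \<open>m\<close>, so its share of the quotient drops below \<open>e / 2\<close> for large
      \<open>s\<close>.\<close>
    define B where "B = (\<Sum>r<m. f r)"
    obtain N where N: "2 * B / e < real N" using reals_Archimedean2 by blast
    have "\<bar>f s / real s - L\<bar> < e" if s: "Suc N \<le> s" for s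
    proof -
      have "L \<le> f s / real s" unfolding L_def using s by (intro cINF_lower[OF bdd]) auto
      have "f (s mod m) \<le> B" unfolding B_def using m by (intro member_le_sum) (auto simp: nonneg)
      then have "f s \<le> real (s div m) * f m + B" using mult[of "s div m" m "s mod m"] by simp
      also have "real (s div m) * f m \<le> real s / real m * f m"
        by (intro mult_right_mono nonneg of_nat_div_le_of_nat)
      also have "\<dots> = real s * (f m / real m)" by simp
      also have "\<dots> < real s * (L + e / 2)" using m s by (intro mult_strict_left_mono) auto
      also have "B < real s * (e / 2)"
      proof -
        have "2 * B / e < real s" using N s by linarith
        then show ?thesis using \<open>0 < e\<close> by (simp add: field_simps)
      qed
      finally have "f s < real s * (L + e)" by (simp add: algebra_simps)
      then have "f s / real s < L + e" using s by (simp add: field_simps)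
      with \<open>L \<le> f s / real s\<close> show ?thesis by linarith
    qed
    then show "\<exists>no. \<forall>s\<ge>no. norm (f s / real s - L) < e" by auto
  qed
  then show ?thesis by (auto simp: convergent_def)
qed

section \<open>Edges of the Newton polygon\<close>

text \<open>The line of slope \<alpha> through the point touches the polygon nowhere else. Below,
  \<open>f\<close> is the height above this line.\<close>

lemma extreme_newton_polygon:
  assumes p: "p \<in> finite_support a n" and am: "\<forall>i\<le>n. a i \<noteq> -\<infinity>"
    and strict: "\<And>j. j \<in> finite_support a n \<Longrightarrow> j \<noteq> p \<Longrightarrow>
      real_of_ereal (a p) + \<alpha> * (real j - real p) < real_of_ereal (a j)"
  shows "(real p, real_of_ereal (a p)) extreme_point_of newton_polygon a n"
proof -
  let ?P = "(real p, real_of_ereal (a p))"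
  define f where "f x = snd x - real_of_ereal (a p) - \<alpha> * (fst x - real p)" for x :: "real \<times> real"
  have f_lin: "f (u *\<^sub>R x + v *\<^sub>R y) = u * f x + v * f y" if "u + v = 1" for u v x y
  proof -
    have v: "v = 1 - u" using that by simp
    show ?thesis unfolding v f_def by (simp add: algebra_simps)
  qed
  have fP: "f ?P = 0" by (simp add: f_def)
  have pos: "0 < f x \<or> x = ?P" if "x \<in> newton_polygon a n" for x
  proof -
    let ?S = "{x. 0 < f x \<or> x = ?P}"
    \<comment> \<open>An open half-plane stays convex when one point of its boundary is added; as it
      contains the generating rays, it contains their hull.\<close>
    have "convex ?S"
    proof (rule convexI)
      fix x y :: "real \<times> real" and u v :: real
      assume *: "x \<in> ?S" "y \<in> ?S" "0 \<le> u" "0 \<le> v" "u + v = 1"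
      show "u *\<^sub>R x + v *\<^sub>R y \<in> ?S"
      proof (cases "u = 0 \<or> v = 0 \<or> x = ?P \<and> y = ?P")
        case True
        have "u *\<^sub>R ?P + v *\<^sub>R ?P = ?P"
          unfolding scaleR_left_distrib[symmetric] *(5) by (rule scaleR_one)
        with True show ?thesis
        proof (elim disjE conjE)
          assume "u = 0"
          then show ?thesis using *(2,5) by simp
        next
          assume "v = 0"
          then show ?thesis using *(1,5) by simp
        next
          assume "x = ?P" "y = ?P" "u *\<^sub>R ?P + v *\<^sub>R ?P = ?P"
          then show ?thesis by (simp only: mem_Collect_eq) simp
        qed
      next
        case False
        then have "0 < u" "0 < v" "0 \<le> f x" "0 \<le> f y" "0 < f x \<or> 0 < f y" using * fP by auto
        then have "0 < u * f x + v * f y" by (metis add_nonneg_pos add_pos_nonneg less_imp_le mult_nonneg_nonneg mult_pos_pos)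
        then show ?thesis using f_lin[OF *(5)] by simp
      qed
    qed
    moreover have "{(real i, b) | i b. i \<in> finite_support a n \<and> a i \<le> ereal b} \<subseteq> ?S"
    proof
      fix x assume "x \<in> {(real i, b) | i b. i \<in> finite_support a n \<and> a i \<le> ereal b}"
      then obtain i b where i: "x = (real i, b)" "i \<in> finite_support a n" "a i \<le> ereal b" by blast
      then have "real_of_ereal (a i) \<le> b" using am by (cases "a i") (auto simp: finite_support_def)
      then show "x \<in> ?S" using strict[of i] i(1,2) by (cases "i = p") (auto simp: f_def)
    qed
    ultimately have "newton_polygon a n \<subseteq> ?S" unfolding newton_polygon_def by (rule hull_minimal[rotated])
    with that show ?thesis by auto
  qed
  have "?P \<in> newton_polygon a n"
    unfolding newton_polygon_def
  proof (rule hull_inc)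
    have "a p \<le> ereal (real_of_ereal (a p))" using p am by (cases "a p") (auto simp: finite_support_def)
    then show "?P \<in> {(real i, b) | i b. i \<in> finite_support a n \<and> a i \<le> ereal b}" using p by blast
  qed
  moreover have "?P \<notin> open_segment x y" if xy: "x \<in> newton_polygon a n" "y \<in> newton_polygon a n" for x y
  proof
    assume "?P \<in> open_segment x y"
    then obtain u where u: "x \<noteq> y" "0 < u" "u < 1" "?P = (1 - u) *\<^sub>R x + u *\<^sub>R y"
      unfolding in_segment by blast
    then have "(1 - u) * f x + u * f y = 0" using f_lin[of "1 - u" u x y] fP by simp
    moreover have "0 \<le> f w" if "w \<in> newton_polygon a n" for w
      using pos[OF that] fP by (metis order_less_imp_le order_refl)
    then have "0 \<le> f x" "0 \<le> f y" using xy by blast+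
    ultimately have "f x = 0" "f y = 0" using u
      by (auto simp: add_nonneg_eq_0_iff)
    then have "x = ?P" "y = ?P" using pos[OF xy(1)] pos[OF xy(2)] by simp_all
    with u(1) show False by simp
  qed
  ultimately show ?thesis unfolding extreme_point_of_def by blast
qed

text \<open>If d is the length of an edge starting at 0, then d divides every element of
  \<open>J\<close>. Any two points of \<open>J\<close> on a common supporting line have a difference
  that is divisible by d and divides d, hence equals d. So the edges lead through all multiples of d
  up to \<open>n\<close>, and each of these is a strict vertex.\<close>

lemma congruent_edges_imp_strictly_convex:
  fixes A :: "nat \<Rightarrow> real"
  assumes J: "J \<subseteq> {..n}" "0 \<in> J" "n \<in> J" "0 < n"
    and E: "\<And>p q \<alpha> j. p \<in> J \<Longrightarrow> q \<in> J \<Longrightarrow> p < q \<Longrightarrow> A q = A p + \<alpha> * (real q - real p) \<Longrightarrow>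
      (\<forall>i\<in>J. A p + \<alpha> * (real i - real p) \<le> A i) \<Longrightarrow> j \<in> J \<Longrightarrow> j mod (q - p) = p mod (q - p)"
  shows "arith_prog J" and "\<forall>p\<in>J. \<exists>\<alpha>. \<forall>j\<in>J. j \<noteq> p \<longrightarrow> A p + \<alpha> * (real j - real p) < A j"
proof -
  \<comment> \<open>\<open>sup p \<alpha>\<close> means that the line of slope \<alpha> through the
    point over \<open>p\<close> supports all points of \<open>J\<close> from below; it is not a
    supremum.\<close>
  define sup where "sup p \<alpha> \<longleftrightarrow> (\<forall>i\<in>J. A p + \<alpha> * (real i - real p) \<le> A i)" for p \<alpha>
  have fin: "finite J" using J finite_subset by blast
  have next_edge: "\<exists>q\<in>J. p < q \<and> (\<exists>\<sigma>. A q = A p + \<sigma> * (real q - real p) \<and> sup p \<sigma>)"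
    if p: "p \<in> J" "p < n" "sup p \<alpha>" for p \<alpha>
  proof -
    \<comment> \<open>The right end of the edge is a point of least slope as seen from
      \<open>p\<close>. This slope is at least \<alpha>, so turning the line to it only lowers the
      line to the left of \<open>p\<close>.\<close>
    define sl where "sl q = (A q - A p) / (real q - real p)" for q
    obtain q where q: "q \<in> {j\<in>J. p < j}" "\<forall>j\<in>{j\<in>J. p < j}. sl q \<le> sl j"
      using ex_is_arg_min_if_finite[of "{j\<in>J. p < j}" sl] fin p J by (fastforce simp: is_arg_min_linorder)
    have line: "A j = A p + sl j * (real j - real p)" if "p < j" for j using that by (simp add: sl_def)
    have "\<alpha> * (real q - real p) \<le> sl q * (real q - real p)"
      using p(3) line[of q] q(1) by (auto simp: sup_def)
    then have \<alpha>: "\<alpha> \<le> sl q" using q(1) by simp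
    have "A p + sl q * (real j - real p) \<le> A j" if j: "j \<in> J" for j
    proof (cases "p < j")
      case True
      then have "sl q * (real j - real p) \<le> sl j * (real j - real p)" using q j by (intro mult_right_mono) auto
      then show ?thesis using line[OF True] by simp
    next
      case False
      then have "sl q * (real j - real p) \<le> \<alpha> * (real j - real p)" using \<alpha> by (intro mult_right_mono_neg) auto
      then show ?thesis using p(3) j by (force simp: sup_def)
    qed
    with q(1) line[of q] show ?thesis by (auto simp: sup_def)
  qed
  have "\<exists>\<alpha>. sup 0 \<alpha>"
  proof -
    \<comment> \<open>A slope so negative that already at distance 1 the line has dropped below
      every value.\<close>
    define \<alpha> where "\<alpha> = - (\<Sum>j\<in>J. \<bar>A j - A 0\<bar>)"
    have "A 0 + \<alpha> * real j \<le> A j" if j: "j \<in> J" for j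
    proof (cases "j = 0")
      case False
      have "\<bar>A j - A 0\<bar> \<le> - \<alpha>" unfolding \<alpha>_def minus_minus using j fin by (intro member_le_sum) auto
      moreover have "- \<alpha> \<le> - \<alpha> * real j" using False \<open>\<bar>A j - A 0\<bar> \<le> - \<alpha>\<close>
        using mult_left_mono[of 1 "real j" "- \<alpha>"] by fastforce
      ultimately show ?thesis by linarith
    qed simp
    then show ?thesis by (auto simp: sup_def)
  qed
  then obtain \<alpha>0 where sup0: "sup 0 \<alpha>0" by blast
  then obtain d \<sigma>0 where d: "d \<in> J" "0 < d" "A d = A 0 + \<sigma>0 * (real d - real 0)" "sup 0 \<sigma>0"
    using next_edge[OF J(2,4) sup0] by blast
  have dvd: "d dvd j" if "j \<in> J" for j
    using E[OF J(2) d(1,2,3) _ that] d(4) by (simp add: sup_def mod_eq_0_iff_dvd)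
  have touch: "v - u = d" if "sup p \<alpha>" "u \<in> J" "v \<in> J" "u < v"
    "A u = A p + \<alpha> * (real u - real p)" "A v = A p + \<alpha> * (real v - real p)" for p \<alpha> u v
  proof -
    have line: "A u + \<alpha> * (real i - real u) = A p + \<alpha> * (real i - real p)" for i
      using that(5) by (simp add: algebra_simps)
    have "j mod (v - u) = u mod (v - u)" if "j \<in> J" for j
      using E[of u v \<alpha> j] \<open>u \<in> J\<close> \<open>v \<in> J\<close> \<open>u < v\<close> \<open>A v = _\<close> \<open>sup p \<alpha>\<close> that
      unfolding line sup_def by blast
    \<comment> \<open>Both 0 and \<open>d\<close> lie in \<open>J\<close>, so both are congruent to
      \<open>u\<close> modulo \<open>v - u\<close>.\<close>
    then have "d mod (v - u) = 0 mod (v - u)" using d(1) J(2) by metis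
    then have "v - u dvd d" by (simp add: mod_eq_0_iff_dvd)
    moreover have "d dvd v - u" using dvd that by (simp add: dvd_diff_nat)
    ultimately show ?thesis by (rule dvd_antisym)
  qed
  have right: "p + d \<in> J \<and> (\<exists>\<sigma>. A (p + d) = A p + \<sigma> * real d \<and> sup p \<sigma>)"
    if p: "p \<in> J" "p < n" "sup p \<alpha>" for p \<alpha>
  proof -
    obtain q \<sigma> where q: "q \<in> J" "p < q" "A q = A p + \<sigma> * (real q - real p)" "sup p \<sigma>"
      using next_edge[OF p] by blast
    then have "q - p = d" using touch[of p \<sigma> p q] p by simp
    then have "q = p + d" using q by simp
    with q show ?thesis by auto
  qed
  have shift: "sup q \<sigma>" if "sup p \<sigma>" "A q = A p + \<sigma> * (real q - real p)" for p q \<sigma>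
    using that by (auto simp: sup_def algebra_simps)
  have all: "t * d \<in> J \<and> (\<exists>\<alpha>. sup (t * d) \<alpha>)" if "t * d \<le> n" for t
    using that
  proof (induction t)
    case 0
    then show ?case using J sup0 by auto
  next
    case (Suc t)
    then have "t * d < n" using d by simp
    with Suc obtain \<alpha> where "t * d \<in> J" "sup (t * d) \<alpha>" by auto
    from right[OF this(1) \<open>t * d < n\<close> this(2)] obtain \<sigma> where
      "t * d + d \<in> J" "A (t * d + d) = A (t * d) + \<sigma> * real d" "sup (t * d) \<sigma>" by blast
    then show ?case using shift[of "t * d" \<sigma> "t * d + d"] by (auto simp: add.commute)
  qed
  have "J = {0 + d * j | j. j \<le> n div d}"
  proof (intro equalityI subsetI)
    fix x assume "x \<in> J"
    then obtain k where "x = d * k" using dvd by blast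
    moreover have "k \<le> n div d" using \<open>x \<in> J\<close> J(1) \<open>x = d * k\<close> d(2)
      by (auto simp: less_eq_div_iff_mult_less_eq mult.commute)
    ultimately show "x \<in> {0 + d * j | j. j \<le> n div d}" by auto
  next
    fix x assume "x \<in> {0 + d * j | j. j \<le> n div d}"
    then obtain j where "x = j * d" "j * d \<le> n" using d(2)
      by (auto simp: less_eq_div_iff_mult_less_eq mult.commute)
    then show "x \<in> J" using all by auto
  qed
  then show "arith_prog J" unfolding arith_prog_def by blast
  show "\<forall>p\<in>J. \<exists>\<alpha>. \<forall>j\<in>J. j \<noteq> p \<longrightarrow> A p + \<alpha> * (real j - real p) < A j"
  proof
    fix p assume p: "p \<in> J"
    then obtain t where t: "p = t * d" using dvd by (metis dvd_def mult.commute)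
    then obtain \<alpha> where \<alpha>: "sup p \<alpha>" using all[of t] p J by auto
    consider "p = n" | "p = 0" | "0 < p" "p < n" using p J by fastforce
    then show "\<exists>\<alpha>. \<forall>j\<in>J. j \<noteq> p \<longrightarrow> A p + \<alpha> * (real j - real p) < A j"
    proof cases
      case 1
      \<comment> \<open>All other points lie to the left, so a steeper line falls strictly below
        them; at \<open>p = 0\<close> the slope is decreased instead.\<close>
      have "A p + (\<alpha> + 1) * (real j - real p) < A j" if "j \<in> J" "j \<noteq> p" for j
      proof -
        have "j < p" using that J 1 by fastforce
        then have "(\<alpha> + 1) * (real j - real p) < \<alpha> * (real j - real p)" by (simp add: algebra_simps)
        then show ?thesis using \<alpha> that by (force simp: sup_def)
      qed
      then show ?thesis by blast
    next
      case 2
      have "A p + (\<alpha> - 1) * (real j - real p) < A j" if "j \<in> J" "j \<noteq> p" for j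
      proof -
        have "p < j" using that 2 by simp
        then have "(\<alpha> - 1) * (real j - real p) < \<alpha> * (real j - real p)" by (simp add: algebra_simps)
        then show ?thesis using \<alpha> that by (force simp: sup_def)
      qed
      then show ?thesis by blast
    next
      case 3
      obtain \<sigma>2 where r: "p + d \<in> J" "A (p + d) = A p + \<sigma>2 * real d" "sup p \<sigma>2"
        using right[OF p 3(2) \<alpha>] by blast
      obtain t' where t': "t = Suc t'" using 3 t by (cases t) auto
      define p' where "p' = t' * d"
      have p': "p = p' + d" by (simp add: p'_def t t')
      obtain \<alpha>' where "p' \<in> J" "sup p' \<alpha>'" using all[of t'] p' 3 unfolding p'_def by auto
      with right[of p' \<alpha>'] 3 p' obtain \<sigma>1 where l: "A p = A p' + \<sigma>1 * real d" "sup p' \<sigma>1" by auto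
      have l': "sup p \<sigma>1" using shift[OF l(2), of p] l(1) p' by simp
      \<comment> \<open>The mean of the slopes of the edges to the left and right of
        \<open>p\<close> works unless \<open>j\<close> lies on both of these lines.\<close>
      have "A p + (\<sigma>1 + \<sigma>2) / 2 * (real j - real p) < A j" if j: "j \<in> J" "j \<noteq> p" for j
      proof -
        have le: "A p + \<sigma>1 * (real j - real p) \<le> A j" "A p + \<sigma>2 * (real j - real p) \<le> A j"
          using l' r j by (auto simp: sup_def)
        have "\<not> (A j = A p + \<sigma>1 * (real j - real p) \<and> A j = A p + \<sigma>2 * (real j - real p))"
        proof
          assume *: "A j = A p + \<sigma>1 * (real j - real p) \<and> A j = A p + \<sigma>2 * (real j - real p)"
          have tp': "A p' = A p + \<sigma>1 * (real p' - real p)" using l(1) p' by (simp add: algebra_simps)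
          have tp: "A p = A p + \<sigma>1 * (real p - real p)" by simp
          have tr: "A (p + d) = A p + \<sigma>2 * (real (p + d) - real p)" using r by simp
          \<comment> \<open>By \<open>touch\<close>, \<open>j\<close> has distance \<open>d\<close>
            from \<open>p\<close>, and distance 0 or \<open>d\<close> from each of
            \<open>p - d\<close> and \<open>p + d\<close>. The first makes it one of the latter two,
            at distance \<open>2 * d\<close> from the other.\<close>
          have "\<bar>int j - int p\<bar> = int d"
            using touch[OF l' p j(1) _ tp] touch[OF l' j(1) p _ _ tp] * j(2)
            by (cases "p < j") auto
          moreover have "j = p' \<or> \<bar>int j - int p'\<bar> = int d"
            using touch[OF l' \<open>p' \<in> J\<close> j(1) _ tp'] touch[OF l' j(1) \<open>p' \<in> J\<close> _ _ tp'] *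
            by (cases j p' rule: linorder_cases) auto
          moreover have "j = p + d \<or> \<bar>int j - int (p + d)\<bar> = int d"
            using touch[OF r(3) r(1) j(1) _ tr] touch[OF r(3) j(1) r(1) _ _ tr] *
            by (cases j "p + d" rule: linorder_cases) auto
          ultimately show False using p' d(2) by linarith
        qed
        then have "(A p + \<sigma>1 * (real j - real p)) + (A p + \<sigma>2 * (real j - real p)) < 2 * A j"
          using le by linarith
        then show ?thesis by (simp add: field_simps)
      qed
      then show ?thesis by blast
    qed
  qed
qed

text \<open>Failure of regularity yields a supporting line through the points over \<open>p\<close>
  and \<open>q\<close> and a finite entry outside the residue class of \<open>p\<close>. Among such
  entries, \<open>r\<close> has the least height \<open>h\<close> above the line;
  \<open>h = 0\<close> may occur. Infinite entries satisfy the inequalities trivially.\<close>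

lemma not_regular_obtains_edge:
  assumes "1 \<le> n" and am: "\<forall>i\<le>n. a i \<noteq> -\<infinity>" and "a 0 \<noteq> \<infinity>" "a n \<noteq> \<infinity>" "\<not> regular a n"
  obtains p q r \<alpha> \<beta> h where "p < q" "q \<le> n" "r \<le> n" "0 \<le> h"
    "r mod (q - p) \<noteq> p mod (q - p)"
    "\<And>i. i \<le> n \<Longrightarrow> ereal (\<alpha> * real i + \<beta>) \<le> a i"
    "\<And>i. i \<le> n \<Longrightarrow> i mod (q - p) \<noteq> p mod (q - p) \<Longrightarrow> ereal (\<alpha> * real i + \<beta> + h) \<le> a i"
    "a p = ereal (\<alpha> * real p + \<beta>)" "a q = ereal (\<alpha> * real q + \<beta>)" "a r = ereal (\<alpha> * real r + \<beta> + h)"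
proof -
  define J where "J = finite_support a n"
  define A where "A i = real_of_ereal (a i)" for i
  have J: "J \<subseteq> {..n}" "0 \<in> J" "n \<in> J" "0 < n" using assms by (auto simp: J_def finite_support_def)
  have aA: "a i = ereal (A i)" if "i \<in> J" for i
    using that am by (cases "a i") (auto simp: A_def J_def finite_support_def)
  have "\<exists>p q \<alpha> j. p \<in> J \<and> q \<in> J \<and> p < q \<and> A q = A p + \<alpha> * (real q - real p) \<and>
      (\<forall>i\<in>J. A p + \<alpha> * (real i - real p) \<le> A i) \<and> j \<in> J \<and> j mod (q - p) \<noteq> p mod (q - p)"
  proof (rule ccontr)
    assume "\<not> ?thesis"
    then have E: "j mod (q - p) = p mod (q - p)" if "p \<in> J" "q \<in> J" "p < q" "A q = A p + \<alpha> * (real q - real p)"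
      "\<forall>i\<in>J. A p + \<alpha> * (real i - real p) \<le> A i" "j \<in> J" for p q \<alpha> j
      using that by blast
    have conv: "arith_prog J" "\<forall>p\<in>J. \<exists>\<alpha>. \<forall>j\<in>J. j \<noteq> p \<longrightarrow> A p + \<alpha> * (real j - real p) < A j"
      by (rule congruent_edges_imp_strictly_convex[OF J, where A = A]; rule E; assumption)+
    have "regular a n"
      unfolding regular_def
    proof (intro conjI ballI)
      show "arith_prog (finite_support a n)" using conv(1) by (simp add: J_def)
      fix p assume p: "p \<in> finite_support a n"
      then obtain \<alpha> where "\<forall>j\<in>J. j \<noteq> p \<longrightarrow> A p + \<alpha> * (real j - real p) < A j"
        using conv(2) by (auto simp: J_def)
      then show "(real p, real_of_ereal (a p)) extreme_point_of newton_polygon a n"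
        using extreme_newton_polygon[OF p am, of \<alpha>] by (auto simp: A_def J_def)
    qed
    with assms show False by simp
  qed
  then obtain p q \<alpha> j where *: "p \<in> J" "q \<in> J" "p < q" "A q = A p + \<alpha> * (real q - real p)"
    "\<And>i. i \<in> J \<Longrightarrow> A p + \<alpha> * (real i - real p) \<le> A i" "j \<in> J" "j mod (q - p) \<noteq> p mod (q - p)" by blast
  define \<beta> where "\<beta> = A p - \<alpha> * real p"
  let ?K = "{i\<in>J. i mod (q - p) \<noteq> p mod (q - p)}"
  have "finite ?K" using J(1) finite_subset by fastforce
  then obtain r where r: "r \<in> ?K" "\<forall>i\<in>?K. A r - \<alpha> * real r - \<beta> \<le> A i - \<alpha> * real i - \<beta>"
    using ex_is_arg_min_if_finite[of ?K "\<lambda>i. A i - \<alpha> * real i - \<beta>"] *(6,7)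
    by (fastforce simp: is_arg_min_linorder)
  define h where "h = A r - \<alpha> * real r - \<beta>"
  have inf: "a i = \<infinity>" if "i \<le> n" "i \<notin> J" for i using that by (simp add: J_def finite_support_def)
  show ?thesis
  proof (rule that[of p q r h \<alpha> \<beta>])
    show "0 \<le> h" using *(5)[of r] r(1) by (simp add: h_def \<beta>_def algebra_simps)
    show "ereal (\<alpha> * real i + \<beta>) \<le> a i" if "i \<le> n" for i
      using *(5)[of i] aA[of i] inf[OF that] by (cases "i \<in> J") (auto simp: \<beta>_def algebra_simps)
    show "ereal (\<alpha> * real i + \<beta> + h) \<le> a i" if "i \<le> n" "i mod (q - p) \<noteq> p mod (q - p)" for i
      using r(2) that(2) aA[of i] inf[OF that(1)] by (cases "i \<in> J") (auto simp: h_def)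
    show "p < q" "q \<le> n" "r \<le> n" "r mod (q - p) \<noteq> p mod (q - p)" using *(2,3) r(1) J(1) by auto
    show "a p = ereal (\<alpha> * real p + \<beta>)" using aA[OF *(1)] by (simp add: \<beta>_def)
    show "a q = ereal (\<alpha> * real q + \<beta>)" using aA[OF *(2)] *(4) by (simp add: \<beta>_def algebra_simps)
    show "a r = ereal (\<alpha> * real r + \<beta> + h)" using aA[of r] r(1) by (simp add: h_def)
  qed
qed

section \<open>Free coordinates\<close>

lemma min_twiceI:
  assumes "i \<le> n" "j \<le> n" "i \<noteq> j" "f i = \<mu>" "f j = \<mu>" "\<And>l. l \<le> n \<Longrightarrow> \<mu> \<le> f l"
  shows "min_twice n f"
proof -
  have "Min (f ` {..n}) = \<mu>" using assms by (intro Min_eqI) auto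
  with assms show ?thesis unfolding min_twice_def by (intro exI[of _ i] exI[of _ j]) simp
qed

text \<open>The vertices are \<open>z\<close> and its translates by the unit vectors of
  \<open>F\<close>. Their convex combinations agree with \<open>z\<close> off \<open>F\<close> and
  only increase it on \<open>F\<close>.\<close>

lemma contains_simplex_free_coordinates:
  assumes F: "F \<subseteq> {1..s}" and z: "\<And>j. j \<notin> {1..s} \<Longrightarrow> z j = 0"
    and S: "\<And>x. (\<And>j. j \<notin> F \<Longrightarrow> x j = z j) \<Longrightarrow> (\<And>j. j \<in> F \<Longrightarrow> z j \<le> x j) \<Longrightarrow> x \<in> S"
  shows "contains_simplex s S (card F)"
proof -
  have "finite F" using F finite_subset by blast
  let ?k = "card F"
  obtain e where e: "bij_betw e {1..?k} F"
    using \<open>finite F\<close> by (metis ex_bij_betw_nat_finite_1)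
  \<comment> \<open>Index 0 lies outside \<open>{1..?k}\<close>, so \<open>p 0\<close> is
    \<open>z\<close> itself.\<close>
  define p where "p i j = z j + (if i \<in> {1..?k} \<and> j = e i then 1 else 0)" for i j
  have eF: "e i \<in> F" if "i \<in> {1..?k}" for i using e that by (auto dest: bij_betwE)
  have "aff_indep s ?k p"
    unfolding aff_indep_def
  proof (intro allI impI ballI)
    fix c :: "nat \<Rightarrow> real" and m assume *: "\<forall>j\<in>{1..s}. (\<Sum>i\<in>{1..?k}. c i * (p i j - p 0 j)) = 0" "m \<in> {1..?k}"
    have "(\<Sum>i\<in>{1..?k}. c i * (p i (e m) - p 0 (e m))) = (\<Sum>i\<in>{1..?k}. if i = m then c i else 0)"
    proof (intro sum.cong refl)
      fix i assume i: "i \<in> {1..?k}"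
      then have "e m = e i \<longleftrightarrow> i = m" using e *(2) by (auto simp: bij_betw_def dest: inj_onD)
      then show "c i * (p i (e m) - p 0 (e m)) = (if i = m then c i else 0)" using i by (simp add: p_def)
    qed
    also have "\<dots> = c m" using *(2) by simp
    finally show "c m = 0" using *(1) eF[OF *(2)] F by auto
  qed
  moreover have "(\<lambda>j. \<Sum>i\<le>?k. l i * p i j) \<in> S" if l: "\<forall>i\<le>?k. 0 \<le> l i" "(\<Sum>i\<le>?k. l i) = 1" for l :: "nat \<Rightarrow> real"
  proof (rule S)
    have eq: "(\<Sum>i\<le>?k. l i * p i j) = z j + (\<Sum>i\<le>?k. l i * (p i j - z j))" for j
    proof -
      have "(\<Sum>i\<le>?k. l i * p i j) = (\<Sum>i\<le>?k. l i) * z j + (\<Sum>i\<le>?k. l i * (p i j - z j))"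
        by (simp add: right_diff_distrib sum_subtractf sum_distrib_right[symmetric])
      with l show ?thesis by simp
    qed
    show "(\<Sum>i\<le>?k. l i * p i j) = z j" if "j \<notin> F" for j
    proof -
      have "(\<Sum>i\<le>?k. l i * (p i j - z j)) = 0"
        using that eF by (intro sum.neutral) (auto simp: p_def)
      with eq show ?thesis by simp
    qed
    show "z j \<le> (\<Sum>i\<le>?k. l i * p i j)" for j
      unfolding eq using l by (auto simp: p_def intro!: sum_nonneg)
  qed
  moreover have "p i j = 0" if "j \<notin> {1..s}" for i j
    using that z[of j] eF[of i] F by (auto simp: p_def simp del: atLeastAtMost_iff)
  ultimately show ?thesis unfolding contains_simplex_def by blast
qed

lemma third_independent_set:
  assumes V: "finite V" and f: "inj_on f V" "\<And>x. x \<in> V \<Longrightarrow> f x \<noteq> x"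
  obtains C where "C \<subseteq> V" "C \<inter> f ` C = {}" "card V \<le> 3 * card C"
proof -
  let ?S = "{C \<in> Pow V. C \<inter> f ` C = {}}"
  have "finite ?S" "?S \<noteq> {}" using V by auto
  from finite_has_maximal[OF this] obtain C where
    "C \<in> ?S" and mx: "\<forall>D\<in>?S. C \<subseteq> D \<longrightarrow> C = D" by blast
  then have C: "C \<subseteq> V" "C \<inter> f ` C = {}" by auto
  have fin: "finite C" using C V finite_subset by auto
  have "V \<subseteq> C \<union> f ` C \<union> {x\<in>V. f x \<in> C}"
  proof
    fix x assume x: "x \<in> V"
    have "x \<in> C" if "x \<notin> f ` C" "f x \<notin> C"
    proof (rule ccontr)
      assume "x \<notin> C"
      moreover have "insert x C \<in> ?S" using C x that f(2)[OF x] by auto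
      ultimately show False using mx by blast
    qed
    with x show "x \<in> C \<union> f ` C \<union> {x\<in>V. f x \<in> C}" by blast
  qed
  then have "card V \<le> card (C \<union> f ` C \<union> {x\<in>V. f x \<in> C})" using V fin by (intro card_mono) auto
  also have "\<dots> \<le> card C + card (f ` C) + card {x\<in>V. f x \<in> C}"
    by (meson add_le_mono1 card_Un_le le_trans)
  also have "card (f ` C) \<le> card C" using fin by (rule card_image_le)
  also have "card {x\<in>V. f x \<in> C} \<le> card C"
    using fin f(1) by (intro card_inj_on_le[of f]) (auto simp: inj_on_def)
  finally have "card V \<le> 3 * card C" by simp
  then show ?thesis by (rule that[OF C])
qed

lemma third_independent_residues:
  fixes m p r :: nat
  assumes "0 < m" "r mod m \<noteq> p mod m"
  obtains C where "C \<subseteq> {..<m}" "m \<le> 3 * card C"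
    "\<And>j. (j + p) mod m \<in> C \<Longrightarrow> (j + r) mod m \<notin> C"
proof -
  \<comment> \<open>Translation of residues by \<open>r - p\<close>, computed in the integers
    because the difference may be negative. It is injective, and free of fixed points since
    \<open>r\<close> and \<open>p\<close> are incongruent.\<close>
  define f where "f x = nat ((int x + (int r - int p)) mod int m)" for x
  have cong: "x mod m = y mod m" if "f (j + x) = f (j + y)" for j x y
  proof -
    have "(int (j + x) + (int r - int p)) mod int m = (int (j + y) + (int r - int p)) mod int m"
      using that assms by (simp add: f_def eq_nat_nat_iff)
    then have "int m dvd int x - int y" by (simp add: mod_eq_dvd_iff algebra_simps)
    then show ?thesis by (metis mod_eq_dvd_iff of_nat_eq_iff of_nat_mod)
  qed
  have f: "f ((j + p) mod m) = (j + r) mod m" for j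
  proof -
    have "(int ((j + p) mod m) + (int r - int p)) mod int m = (int (j + p) + (int r - int p)) mod int m"
      by (simp add: of_nat_mod mod_simps)
    also have "\<dots> = int ((j + r) mod m)" by (simp add: of_nat_mod)
    finally show ?thesis by (simp add: f_def)
  qed
  have inj: "inj_on f {..<m}"
    using cong[of 0] by (force simp: inj_on_def)
  have nofix: "f x \<noteq> x" if "x \<in> {..<m}" for x
  proof
    assume "f x = x"
    then have "(int x + (int r - int p)) mod int m = int x"
      using assms by (metis f_def int_nat_eq of_nat_0_less_iff pos_mod_sign)
    also have "\<dots> = int x mod int m" using that by simp
    finally have "int m dvd int r - int p" by (simp add: mod_eq_dvd_iff)
    then have "r mod m = p mod m" by (metis mod_eq_dvd_iff of_nat_eq_iff of_nat_mod)
    with assms show False by simp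
  qed
  obtain C where C: "C \<subseteq> {..<m}" "C \<inter> f ` C = {}" "card {..<m} \<le> 3 * card C"
    by (rule third_independent_set[OF finite_lessThan inj nofix])
  show ?thesis
  proof (rule that[OF C(1)])
    show "(j + r) mod m \<notin> C" if "(j + p) mod m \<in> C" for j
      using C(2) f[of j] that by (metis disjoint_iff image_eqI)
  qed (use C in auto)
qed

text \<open>The term \<open>- \<alpha> * real j\<close> cancels the slope of the supporting line: up
  to a constant of the window, each entry is the height of \<open>a i\<close> above the line plus a
  value of \<open>y\<close>.\<close>

lemma tropD_free_coordinates:
  fixes \<alpha> \<beta> h :: real
  assumes pq: "p < q" "q \<le> n" "r \<le> n" "0 \<le> h"
    and r: "r mod (q - p) \<noteq> p mod (q - p)"
    and low: "\<And>i. i \<le> n \<Longrightarrow> ereal (\<alpha> * real i + \<beta>) \<le> a i"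
    and lowh: "\<And>i. i \<le> n \<Longrightarrow> i mod (q - p) \<noteq> p mod (q - p) \<Longrightarrow> ereal (\<alpha> * real i + \<beta> + h) \<le> a i"
    and ap: "a p = ereal (\<alpha> * real p + \<beta>)" and aq: "a q = ereal (\<alpha> * real q + \<beta>)"
    and ar: "a r = ereal (\<alpha> * real r + \<beta> + h)"
    and C: "\<And>j. (j + p) mod (q - p) \<in> C \<Longrightarrow> (j + r) mod (q - p) \<notin> C"
    and y0: "\<And>j. j mod (q - p) \<notin> C \<Longrightarrow> y j = 0"
    and yh: "\<And>j. j mod (q - p) \<in> C \<Longrightarrow> even (j div (q - p)) \<Longrightarrow> y j = h"
    and yge: "\<And>j. j mod (q - p) \<in> C \<Longrightarrow> h \<le> y j"
  shows "(\<lambda>j. if j \<in> {1..s} then y j - \<alpha> * real j else 0) \<in> tropD a n s"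
proof -
  let ?m = "q - p"
  let ?z = "\<lambda>j. if j \<in> {1..s} then y j - \<alpha> * real j else 0"
  have window: "min_twice n (\<lambda>i. a i + ereal (?z (k + 1 + i)))" if k: "k + n + 1 \<le> s" for k
  proof -
    define K where "K = k + 1"
    define g where "g i = a i + ereal (?z (k + 1 + i))" for i
    have g: "g i = a i + ereal (y (K + i) - \<alpha> * real (K + i))" if "i \<le> n" for i
      using that k by (auto simp: g_def K_def)
    have ynonneg: "0 \<le> y j" for j using y0[of j] yge[of j] pq(4) by (cases "j mod ?m \<in> C") auto
    have gval: "g i = ereal (\<beta> - \<alpha> * real K + v)" if "i \<le> n" "a i = ereal (\<alpha> * real i + \<beta> + u)" "v = u + y (K + i)" for i u v
      using that by (simp add: g algebra_simps)
    have gge: "ereal (\<beta> - \<alpha> * real K + v) \<le> g i"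
      if "i \<le> n" "ereal (\<alpha> * real i + \<beta> + u) \<le> a i" "v \<le> u + y (K + i)" for i u v
    proof -
      have "ereal (\<beta> - \<alpha> * real K + v) \<le> ereal (\<alpha> * real i + \<beta> + u) + ereal (y (K + i) - \<alpha> * real (K + i))"
        using that(3) by (simp add: algebra_simps)
      also have "\<dots> \<le> g i" unfolding g[OF that(1)] using that(2) by (rule add_right_mono)
      finally show ?thesis .
    qed
    have q: "K + q = (K + p) + ?m" using pq by simp
    have modq: "(K + q) mod ?m = (K + p) mod ?m" unfolding q by (rule mod_add_self2)
    have divq: "(K + q) div ?m = Suc ((K + p) div ?m)" unfolding q using pq by (subst div_add_self2) auto
    have "min_twice n g"
    proof (cases "(K + p) mod ?m \<in> C")
      case False
      show ?thesis
      proof (rule min_twiceI[of p n q g "ereal (\<beta> - \<alpha> * real K + 0)"])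
        show "ereal (\<beta> - \<alpha> * real K + 0) \<le> g l" if "l \<le> n" for l
          using gge[of l 0 0] low that ynonneg by simp
        show "g p = ereal (\<beta> - \<alpha> * real K + 0)" using gval[of p 0 0] ap y0[OF False] pq by simp
        show "g q = ereal (\<beta> - \<alpha> * real K + 0)" using gval[of q 0 0] aq y0[of "K + q"] False modq pq by simp
      qed (use pq in auto)
    next
      case True
      \<comment> \<open>The positions \<open>K + p\<close> and \<open>K + q\<close> share their
        residue and lie in consecutive blocks of length \<open>q - p\<close>. Hence one of them is
        in an even block, where \<open>y\<close> equals \<open>h\<close>.\<close>
      define e where "e = (if even ((K + p) div ?m) then p else q)"
      have e: "e \<le> n" "y (K + e) = h" "a e = ereal (\<alpha> * real e + \<beta> + 0)" "e mod ?m = p mod ?m"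
        using pq ap aq yh[of "K + p"] yh[of "K + q"] True modq divq
        by (auto simp: e_def mod_nat_eqI le_mod_geq)
      have K_mod: "(K + i) mod ?m = (K + p) mod ?m" if "i mod ?m = p mod ?m" for i
        using that by (metis mod_add_right_eq)
      show ?thesis
      proof (rule min_twiceI[of e n r g "ereal (\<beta> - \<alpha> * real K + h)"])
        show "e \<noteq> r" using e(4) r by auto
        show "g e = ereal (\<beta> - \<alpha> * real K + h)" using gval[of e 0 h] e by simp
        show "g r = ereal (\<beta> - \<alpha> * real K + h)" using gval[of r h h] ar pq y0 C[OF True] by simp
        show "ereal (\<beta> - \<alpha> * real K + h) \<le> g l" if l: "l \<le> n" for l
        \<comment> \<open>In the class of \<open>p\<close> the bound \<open>h\<close> comes from
          \<open>y\<close>; in the other classes it comes from the height above the line.\<close>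
        proof (cases "l mod ?m = p mod ?m")
          case eq: True
          then show ?thesis using gge[of l 0 h] l low yge[of "K + l"] K_mod[OF eq] True by simp
        next
          case False
          then show ?thesis using gge[of l h h] l lowh ynonneg by simp
        qed
      qed (use pq e in auto)
    qed
    then show ?thesis by (simp add: g_def[abs_def])
  qed
  show ?thesis
    unfolding tropD_def mem_Collect_eq
  proof (intro conjI allI impI)
    show "min_twice n (\<lambda>i. a i + ereal (?z (k + 1 + i)))" if "k + n + 1 \<le> s" for k
      by (rule window[OF that])
  qed auto
qed

text \<open>The range contains \<open>N\<close> complete blocks of odd number, and each contributes
  one position per residue in \<open>C\<close>.\<close>

lemma card_free_positions:
  fixes m N :: nat
  assumes "0 < m" "C \<subseteq> {..<m}"
  shows "N * card C \<le> card {j\<in>{1..2 * m * N}. j mod m \<in> C \<and> odd (j div m)}"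
proof -
  let ?f = "\<lambda>(t, x). (2 * t + 1) * m + x"
  have dm: "((2 * t + 1) * m + x) div m = 2 * t + 1" "((2 * t + 1) * m + x) mod m = x"
    if "x \<in> C" for t x
  proof -
    have "x < m" using that assms by auto
    then show "((2 * t + 1) * m + x) div m = 2 * t + 1" "((2 * t + 1) * m + x) mod m = x"
      using div_mult_self3[of m "2 * t + 1" x] mod_mult_self3[of "2 * t + 1" m x] by simp_all
  qed
  have "inj_on ?f ({..<N} \<times> C)"
  proof (rule inj_onI, clarify)
    fix t x t' x' assume *: "x \<in> C" "x' \<in> C" "(2 * t + 1) * m + x = (2 * t' + 1) * m + x'"
    then have "x = x'" "2 * t + 1 = 2 * t' + 1" using dm by metis+
    then show "t = t' \<and> x = x'" by simp
  qed
  moreover have "?f ` ({..<N} \<times> C) \<subseteq> {j\<in>{1..2 * m * N}. j mod m \<in> C \<and> odd (j div m)}"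
  proof
    fix j assume "j \<in> ?f ` ({..<N} \<times> C)"
    then obtain t x where tx: "t < N" "x \<in> C" and j: "j = (2 * t + 1) * m + x" by auto
    have "x < m" using tx assms by auto
    then have "j \<le> (2 * t + 2) * m" by (simp add: j algebra_simps)
    also have "\<dots> \<le> 2 * N * m" using tx by (intro mult_right_mono) auto
    finally have "j \<le> 2 * m * N" by (simp add: ac_simps)
    moreover have "1 \<le> j" using assms(1) by (simp add: j)
    moreover have "j mod m \<in> C" "odd (j div m)" unfolding j dm[OF tx(2)] using tx(2) by simp_all
    ultimately show "j \<in> {j\<in>{1..2 * m * N}. j mod m \<in> C \<and> odd (j div m)}" by simp
  qed
  ultimately have "card ({..<N} \<times> C) \<le> card {j\<in>{1..2 * m * N}. j mod m \<in> C \<and> odd (j div m)}"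
    by (intro card_inj_on_le) auto
  then show ?thesis by (simp add: card_cartesian_product)
qed

section \<open>Subadditivity of the dimension\<close>

lemma min_twice_cong:
  assumes "\<And>i. i \<le> n \<Longrightarrow> f i = g i"
  shows "min_twice n f \<longleftrightarrow> min_twice n g"
proof -
  have "f ` {..n} = g ` {..n}" using assms by (intro image_cong) auto
  then show ?thesis unfolding min_twice_def using assms by metis
qed

text \<open>The conditions do not depend on the position of a window, so any \<open>s\<close>
  consecutive coordinates satisfy those of length \<open>s\<close>.\<close>

lemma tropD_shift:
  assumes z: "z \<in> tropD a n s'" and le: "m + s \<le> s'"
  shows "(\<lambda>j. if j \<in> {1..s} then z (j + m) else 0) \<in> tropD a n s"
proof -
  let ?w = "\<lambda>j. if j \<in> {1..s} then z (j + m) else 0"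
  have window: "min_twice n (\<lambda>i. a i + ereal (?w (k + 1 + i)))" if k: "k + n + 1 \<le> s" for k
  proof -
    have "min_twice n (\<lambda>i. a i + ereal (z (k + m + 1 + i)))"
      using z k le by (auto simp: tropD_def)
    also have "min_twice n (\<lambda>i. a i + ereal (z (k + m + 1 + i))) \<longleftrightarrow>
        min_twice n (\<lambda>i. a i + ereal (?w (k + 1 + i)))"
      using k by (intro min_twice_cong) (auto simp: ac_simps)
    finally show ?thesis .
  qed
  show ?thesis
    unfolding tropD_def mem_Collect_eq
  proof (intro conjI allI impI)
    show "min_twice n (\<lambda>i. a i + ereal (?w (k + 1 + i)))" if "k + n + 1 \<le> s" for k
      by (rule window[OF that])
  qed auto
qed

lemma aff_indep_iff: "aff_indep s k p \<longleftrightarrow> indep_on {1..s} {1..k} (\<lambda>i j. p i j - p 0 j)"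
  by (simp add: aff_indep_def indep_on_def)

lemma contains_simplex_le:
  assumes "contains_simplex s S k"
  shows "k \<le> s"
proof -
  obtain p where "indep_on {1..s} {1..k} (\<lambda>i j. p i j - p 0 j :: real)"
    using assms unfolding contains_simplex_def aff_indep_iff by blast
  from indep_on_card_le[OF _ _ this] show ?thesis by simp
qed

text \<open>The bound by \<open>s\<close> makes the set of dimensions bounded, as the supremum in
  the natural numbers requires.\<close>

lemma poly_dim_upper:
  assumes "contains_simplex s S k"
  shows "k \<le> poly_dim s S"
  unfolding poly_dim_def using assms contains_simplex_le
  by (intro cSup_upper) (auto intro!: bdd_aboveI)

text \<open>The vertices \<open>p 0\<close> and \<open>p i\<close> for \<open>i\<close> in
  \<open>K\<close> span a face; read on the coordinates \<open>m + 1\<close> to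
  \<open>m + s\<close>, it remains a nondegenerate simplex by \<open>ind\<close>.\<close>

lemma contains_simplex_tropD_shift:
  assumes conv: "\<And>l :: nat \<Rightarrow> real. (\<forall>i\<le>k. 0 \<le> l i) \<Longrightarrow> (\<Sum>i\<le>k. l i) = 1 \<Longrightarrow>
      (\<lambda>j. \<Sum>i\<le>k. l i * p i j) \<in> tropD a n s'"
    and le: "m + s \<le> s'"
    and K: "K \<subseteq> {1..k}" and ind: "indep_on {1..s} K (\<lambda>i j. p i (j + m) - p 0 (j + m))"
  shows "contains_simplex s (tropD a n s) (card K)"
proof -
  have finK: "finite K" using K finite_subset by blast
  obtain e where e: "bij_betw e {1..card K} K"
    using finK by (metis ex_bij_betw_nat_finite_1)
  \<comment> \<open>Fixing 0 keeps \<open>p 0\<close> as base vertex; 0 is not in \<open>K\<close>,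
    so the renumbering is injective.\<close>
  define \<sigma> where "\<sigma> i = (if i = 0 then 0 else e i)" for i
  define p' where "p' i j = (if j \<in> {1..s} then p (\<sigma> i) (j + m) else 0)" for i j
  have \<sigma>K: "bij_betw \<sigma> {1..card K} K"
    using e by (rule bij_betw_cong[THEN iffD1, rotated]) (auto simp: \<sigma>_def)
  have inj: "inj_on \<sigma> {..card K}"
  proof (rule inj_onI)
    fix x y assume xy: "x \<in> {..card K}" "y \<in> {..card K}" "\<sigma> x = \<sigma> y"
    have pos: "0 < \<sigma> i" if "i \<in> {1..card K}" for i
      using bij_betwE[OF \<sigma>K] that K by fastforce
    show "x = y"
    proof (cases "x = 0 \<or> y = 0")
      case True
      then show ?thesis using xy pos[of x] pos[of y] by (auto simp: \<sigma>_def split: if_splits)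
    next
      case False
      then have "x \<in> {1..card K}" "y \<in> {1..card K}" using xy by auto
      then show ?thesis using \<sigma>K xy(3) by (auto simp: bij_betw_def dest: inj_onD)
    qed
  qed
  have im: "\<sigma> ` {..card K} \<subseteq> {..k}"
  proof
    fix x assume "x \<in> \<sigma> ` {..card K}"
    then obtain i where i: "i \<le> card K" "x = \<sigma> i" by auto
    show "x \<in> {..k}"
    proof (cases "i = 0")
      case False
      then have "\<sigma> i \<in> K" using bij_betwE[OF \<sigma>K] i by simp
      then show ?thesis using K i by auto
    qed (simp add: i \<sigma>_def)
  qed
  have "aff_indep s (card K) p'"
    unfolding aff_indep_def
  proof (intro allI impI ballI)
    fix c :: "nat \<Rightarrow> real" and i
    assume c: "\<forall>j\<in>{1..s}. (\<Sum>i\<in>{1..card K}. c i * (p' i j - p' 0 j)) = 0" and i: "i \<in> {1..card K}"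
    define c' where "c' x = c (inv_into {1..card K} \<sigma> x)" for x
    have c'\<sigma>: "c' (\<sigma> i) = c i" if "i \<in> {1..card K}" for i
      using that \<sigma>K by (simp add: c'_def bij_betw_def inv_into_f_f)
    have "(\<Sum>x\<in>K. c' x * (p x (j + m) - p 0 (j + m))) = 0" if j: "j \<in> {1..s}" for j
    proof -
      have "(\<Sum>x\<in>K. c' x * (p x (j + m) - p 0 (j + m)))
          = (\<Sum>i\<in>{1..card K}. c' (\<sigma> i) * (p (\<sigma> i) (j + m) - p 0 (j + m)))"
        by (rule sum.reindex_bij_betw[OF \<sigma>K, symmetric])
      also have "\<dots> = (\<Sum>i\<in>{1..card K}. c i * (p' i j - p' 0 j))"
      proof (rule sum.cong[OF refl])
        fix i assume "i \<in> {1..card K}"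
        from c'\<sigma>[OF this] show "c' (\<sigma> i) * (p (\<sigma> i) (j + m) - p 0 (j + m)) = c i * (p' i j - p' 0 j)"
          using j by (simp add: p'_def) (simp add: \<sigma>_def)
      qed
      finally show ?thesis using c j by simp
    qed
    then have "\<forall>x\<in>K. c' x = 0" using ind unfolding indep_on_def by blast
    then show "c i = 0" using c'\<sigma>[OF i] bij_betwE[OF \<sigma>K] i by metis
  qed
  moreover have "(\<lambda>j. \<Sum>i\<le>card K. l i * p' i j) \<in> tropD a n s"
    if l: "\<forall>i\<le>card K. 0 \<le> l i" "(\<Sum>i\<le>card K. l i) = 1" for l :: "nat \<Rightarrow> real"
  proof -
    \<comment> \<open>Weights on the face are extended by 0 to the remaining vertices of the large
      simplex.\<close>
    define l' where "l' x = (if x \<in> \<sigma> ` {..card K} then l (inv_into {..card K} \<sigma> x) else 0)" for x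
    have l'\<sigma>: "l' (\<sigma> i) = l i" if "i \<le> card K" for i
      using that inj by (simp add: l'_def inv_into_f_f)
    have sum_l': "(\<Sum>x\<le>k. l' x * g x) = (\<Sum>i\<le>card K. l i * g (\<sigma> i))" for g
    proof -
      have "(\<Sum>x\<le>k. l' x * g x) = (\<Sum>x\<in>\<sigma> ` {..card K}. l' x * g x)"
        using im by (intro sum.mono_neutral_right) (auto simp: l'_def)
      also have "\<dots> = (\<Sum>i\<le>card K. l' (\<sigma> i) * g (\<sigma> i))" by (simp add: sum.reindex[OF inj])
      also have "\<dots> = (\<Sum>i\<le>card K. l i * g (\<sigma> i))" using l'\<sigma> by (intro sum.cong) auto
      finally show ?thesis .
    qed
    have "(\<Sum>x\<le>k. l' x) = 1" using sum_l'[of "\<lambda>_. 1"] l by simp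
    moreover have "\<forall>x\<le>k. 0 \<le> l' x" using l'\<sigma> l by (auto simp: l'_def)
    ultimately have "(\<lambda>j. \<Sum>x\<le>k. l' x * p x j) \<in> tropD a n s'" by (intro conv)
    from tropD_shift[OF this le]
    have "(\<lambda>j. if j \<in> {1..s} then \<Sum>x\<le>k. l' x * p x (j + m) else 0) \<in> tropD a n s" .
    also have "(\<lambda>j. if j \<in> {1..s} then \<Sum>x\<le>k. l' x * p x (j + m) else 0) =
        (\<lambda>j. \<Sum>i\<le>card K. l i * p' i j)"
    proof
      fix j
      show "(if j \<in> {1..s} then \<Sum>x\<le>k. l' x * p x (j + m) else 0) = (\<Sum>i\<le>card K. l i * p' i j)"
        by (cases "j \<in> {1..s}") (simp_all add: sum_l' p'_def del: atLeastAtMost_iff)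
    qed
    finally show ?thesis .
  qed
  moreover have "\<forall>i\<le>card K. \<forall>j. j \<notin> {1..s} \<longrightarrow> p' i j = 0" by (auto simp: p'_def)
  ultimately show ?thesis unfolding contains_simplex_def by blast
qed

text \<open>The edge vectors of a simplex of top dimension are independent on the first
  \<open>s\<close> together with the last \<open>t\<close> coordinates. \<open>indep_on_Un\<close>
  selects a face for each block, with dimensions adding up to at least the original one.\<close>

lemma d_seq_subadditive: "d_seq a n (s + t) \<le> d_seq a n s + d_seq a n t"
proof -
  let ?X = "{k. contains_simplex (s + t) (tropD a n (s + t)) k}"
  define k where "k = d_seq a n (s + t)"
  have kX: "k = Sup ?X" by (simp add: k_def d_seq_def poly_dim_def)
  show ?thesis
  proof (cases "?X = {}")
    case True
    then have "k = 0" unfolding kX by (simp only: Sup_nat_def) simp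
    then show ?thesis by (simp add: k_def)
  next
    case False
    have "finite ?X" using contains_simplex_le by (auto intro: finite_subset[of _ "{..s + t}"])
    \<comment> \<open>A finite nonempty set attains its supremum, so a simplex of dimension exactly
      \<open>k\<close> exists.\<close>
    then have "Max ?X \<in> ?X" using False by (rule Max_in)
    then have "k \<in> ?X" unfolding kX Sup_nat_def using False by (simp only: if_False)
    then obtain p :: "nat \<Rightarrow> nat \<Rightarrow> real" where
      ind: "indep_on {1..s + t} {1..k} (\<lambda>i j. p i j - p 0 j)" and
      conv: "\<And>l :: nat \<Rightarrow> real. (\<forall>i\<le>k. 0 \<le> l i) \<Longrightarrow> (\<Sum>i\<le>k. l i) = 1 \<Longrightarrow>
        (\<lambda>j. \<Sum>i\<le>k. l i * p i j) \<in> tropD a n (s + t)"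
      unfolding contains_simplex_def aff_indep_iff by blast
    have "{1..s + t} = {1..s} \<union> (\<lambda>j. j + s) ` {1..t}" by (force simp: image_iff)
    with ind have "indep_on ({1..s} \<union> (\<lambda>j. j + s) ` {1..t}) {1..k} (\<lambda>i j. p i j - p 0 j)" by simp
    from indep_on_Un[OF _ this] obtain K L where KL: "K \<subseteq> {1..k}" "L \<subseteq> {1..k}"
      "indep_on {1..s} K (\<lambda>i j. p i j - p 0 j)"
      "indep_on ((\<lambda>j. j + s) ` {1..t}) L (\<lambda>i j. p i j - p 0 j)" "card {1..k} \<le> card K + card L"
      by auto
    have "contains_simplex s (tropD a n s) (card K)"
      using contains_simplex_tropD_shift[OF conv, of 0 s K] KL by simp
    moreover have "indep_on {1..t} L (\<lambda>i j. p i (j + s) - p 0 (j + s))"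
      using KL(4) by (simp only: indep_on_def ball_simps)
    then have "contains_simplex t (tropD a n t) (card L)"
      using contains_simplex_tropD_shift[OF conv, of s t L] KL(2) by simp
    ultimately have "card K \<le> d_seq a n s" "card L \<le> d_seq a n t"
      unfolding d_seq_def by (auto intro: poly_dim_upper)
    then show ?thesis using KL(5) by (simp add: k_def)
  qed
qed

lemma d_seq_convergent: "convergent (\<lambda>s. real (d_seq a n s) / real s)"
  using d_seq_subadditive[of a n] by (intro fekete) (simp_all flip: of_nat_add)

section \<open>The entropy bound\<close>

text \<open>With \<open>s = 2 * m * N\<close> the blocks pair up into even and odd ones, leaving at
  least \<open>N * card C\<close> free coordinates, where \<open>card C\<close> is at least a third
  of \<open>m\<close>.\<close>

lemma d_seq_lower_bound:
  assumes "n \<ge> 1" "\<forall>i\<le>n. a i \<noteq> -\<infinity>" "a 0 \<noteq> \<infinity>" "a n \<noteq> \<infinity>" "\<not> regular a n"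
  obtains m where "0 < m" "\<And>N. m * N \<le> 3 * d_seq a n (2 * m * N)"
proof -
  obtain p q r \<alpha> \<beta> h where edge: "p < q" "q \<le> n" "r \<le> n" "0 \<le> h"
    "r mod (q - p) \<noteq> p mod (q - p)"
    "\<And>i. i \<le> n \<Longrightarrow> ereal (\<alpha> * real i + \<beta>) \<le> a i"
    "\<And>i. i \<le> n \<Longrightarrow> i mod (q - p) \<noteq> p mod (q - p) \<Longrightarrow> ereal (\<alpha> * real i + \<beta> + h) \<le> a i"
    "a p = ereal (\<alpha> * real p + \<beta>)" "a q = ereal (\<alpha> * real q + \<beta>)" "a r = ereal (\<alpha> * real r + \<beta> + h)"
    by (rule not_regular_obtains_edge[OF assms], rule that)
  define m where "m = q - p"
  have m: "0 < m" using edge(1) by (simp add: m_def)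
  obtain C where C: "C \<subseteq> {..<m}" "m \<le> 3 * card C"
    "\<And>j. (j + p) mod m \<in> C \<Longrightarrow> (j + r) mod m \<notin> C"
    using third_independent_residues[OF m edge(5)[folded m_def]] by blast
  have "m * N \<le> 3 * d_seq a n (2 * m * N)" for N
  proof -
    define s where "s = 2 * m * N"
    define F where "F = {j\<in>{1..s}. j mod m \<in> C \<and> odd (j div m)}"
    \<comment> \<open>The base point has the least admissible value \<open>h\<close> at the free
      positions too, since these may only move upwards.\<close>
    define b where "b j = (if j mod m \<in> C then h else 0)" for j
    have "contains_simplex s (tropD a n s) (card F)"
    proof (rule contains_simplex_free_coordinates[where z = "\<lambda>j. if j \<in> {1..s} then b j - \<alpha> * real j else 0"])
      fix x assume x: "\<And>j. j \<notin> F \<Longrightarrow> x j = (if j \<in> {1..s} then b j - \<alpha> * real j else 0)"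
        "\<And>j. j \<in> F \<Longrightarrow> (if j \<in> {1..s} then b j - \<alpha> * real j else 0) \<le> x j"
      \<comment> \<open>Adding \<open>\<alpha> * real j\<close> undoes the tilt; off
        \<open>F\<close>, also outside \<open>{1..s}\<close>, \<open>y\<close> follows
        \<open>b\<close>, so the conditions on \<open>y\<close> hold for every
        \<open>j\<close>.\<close>
      define y where "y j = (if j \<in> F then x j + \<alpha> * real j else b j)" for j
      have "(\<lambda>j. if j \<in> {1..s} then y j - \<alpha> * real j else 0) \<in> tropD a n s"
      proof (rule tropD_free_coordinates[where C = C and p = p and q = q and r = r and h = h and \<beta> = \<beta>])
        show "(j + r) mod (q - p) \<notin> C" if "(j + p) mod (q - p) \<in> C" for j
          using C(3)[of j] that by (simp add: m_def)
        show "y j = 0" if "j mod (q - p) \<notin> C" for j using that by (simp add: y_def b_def F_def m_def)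
        show "y j = h" if "j mod (q - p) \<in> C" "even (j div (q - p))" for j
          using that by (simp add: y_def b_def F_def m_def)
        show "h \<le> y j" if "j mod (q - p) \<in> C" for j
        proof (cases "j \<in> F")
          case True
          then have "j \<in> {1..s}" by (simp add: F_def)
          then show ?thesis using x(2)[OF True] True that by (simp add: y_def b_def m_def)
        qed (use that in \<open>simp add: y_def b_def m_def\<close>)
      qed (fact edge)+
      also have "(\<lambda>j. if j \<in> {1..s} then y j - \<alpha> * real j else 0) = x"
      proof
        fix j
        show "(if j \<in> {1..s} then y j - \<alpha> * real j else 0) = x j"
        proof (cases "j \<in> F")
          case True
          then have "j \<in> {1..s}" by (simp add: F_def)
          with True show ?thesis by (simp add: y_def)
        next
          case False
          then show ?thesis using x(1)[OF False] by (simp add: y_def)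
        qed
      qed
      finally show "x \<in> tropD a n s" .
    qed (auto simp: F_def)
    then have "card F \<le> d_seq a n s" unfolding d_seq_def by (rule poly_dim_upper)
    moreover have "N * card C \<le> card F" unfolding F_def s_def by (rule card_free_positions[OF m C(1)])
    moreover have "m * N \<le> 3 * (N * card C)" using mult_right_mono[OF C(2), of N] by (simp add: ac_simps)
    ultimately show ?thesis unfolding s_def by linarith
  qed
  with m show ?thesis by (rule that)
qed

theorem theorem3:
  fixes a :: "nat \<Rightarrow> ereal" and n :: nat
  assumes "n \<ge> 1"
    and "\<forall>i\<le>n. a i \<noteq> -\<infinity>"
    and "a 0 \<noteq> \<infinity>" and "a n \<noteq> \<infinity>"
    and "\<not> regular a n"
  shows "convergent (\<lambda>s. real (d_seq a n s) / real s) \<and> trop_entropy a n \<ge> 1/6"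
proof
  show conv: "convergent (\<lambda>s. real (d_seq a n s) / real s)" by (rule d_seq_convergent)
  obtain m where m: "0 < m" "\<And>N. m * N \<le> 3 * d_seq a n (2 * m * N)"
    using d_seq_lower_bound[OF assms] by blast
  \<comment> \<open>Convergence is known, so a subsequence determines the limit;
    \<open>Suc N\<close> keeps the denominators positive.\<close>
  have "strict_mono (\<lambda>N. 2 * m * Suc N)" using m(1) by (intro strict_monoI) simp
  with conv have lim: "(\<lambda>N. real (d_seq a n (2 * m * Suc N)) / real (2 * m * Suc N)) \<longlonglongrightarrow> trop_entropy a n"
    using LIMSEQ_subseq_LIMSEQ[of "\<lambda>s. real (d_seq a n s) / real s" "trop_entropy a n" "\<lambda>N. 2 * m * Suc N"]
    by (simp add: trop_entropy_def convergent_LIMSEQ_iff comp_def)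
  have "1 / 6 \<le> real (d_seq a n (2 * m * Suc N)) / real (2 * m * Suc N)" for N
  proof -
    have "2 * m * Suc N \<le> 6 * d_seq a n (2 * m * Suc N)" using m(2)[of "Suc N"] by linarith
    then have "real (2 * m * Suc N) \<le> 6 * real (d_seq a n (2 * m * Suc N))" by linarith
    moreover have "0 < 2 * m * Suc N" using m(1) by simp
    then have "0 < real (2 * m * Suc N)" by (simp only: of_nat_0_less_iff)
    ultimately show ?thesis by (subst pos_le_divide_eq) linarith+
  qed
  with lim show "1 / 6 \<le> trop_entropy a n" by (intro LIMSEQ_le_const) auto
qed

end
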